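(* Let $x\in\mathbb{R}$. The sequences $a\in\mathcal{S}(\mathbb{R})$ fixed by the operator $\eta\circ I^{(x)}$ have ordinary generating function $$\sum_{n\ge0}a_nt^n=\frac{1}{1+\frac{x}{2}t}.$$
   Context: $\mathcal{S}(\mathbb{R})$ denotes the set of real sequences $a=(a_n)_{n\ge0}$ with $a_0=1$. For $x\in\mathbb{R}$, the interpolated invert operator $I^{(x)}$ maps $a$ with ordinary generating function $\mathbf{A}(t)=\sum_n a_nt^n$ to the sequence with ordinary generating function $\frac{\mathbf{A}(t)}{1-xt\mathbf{A}(t)}$. The revert operator $\eta$ is defined by $\eta(a)=b$ iff the power series $u(t)=\sum_{n\ge0}a_nt^{n+1}$ and $t(u)=\sum_{n\ge0}b_nu^{n+1}$ are compositional inverses of each other. Composition: $(\eta\circ I^{(x)})(a)=\eta(I^{(x)}(a))$. *)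

theory Defs
  imports "HOL-Computational_Algebra.Formal_Power_Series"
begin

unbundle fps_syntax

definition S_real :: "(nat \<Rightarrow> real) set" where
  "S_real = {a. a 0 = 1}"

definition ogf :: "(nat \<Rightarrow> real) \<Rightarrow> real fps" where
  "ogf a = Abs_fps a"

definition interp_invert :: "real \<Rightarrow> (nat \<Rightarrow> real) \<Rightarrow> nat \<Rightarrow> real" where
  "interp_invert x a = fps_nth (ogf a / (1 - fps_const x * fps_X * ogf a))"

definition comp_inverses :: "real fps \<Rightarrow> real fps \<Rightarrow> bool" where
  "comp_inverses f g \<longleftrightarrow> f $ 0 = 0 \<and> g $ 0 = 0 \<and> f oo g = fps_X \<and> g oo f = fps_X"

text \<open>
  On \<open>S_real\<close> the description below determines \<open>revert\<close> uniquely; see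
  \<open>revert_eq_iff\<close>. Elsewhere the value may be unspecified.
\<close>

definition revert :: "(nat \<Rightarrow> real) \<Rightarrow> nat \<Rightarrow> real" where
  "revert a = (THE b. comp_inverses (fps_X * ogf a) (fps_X * ogf b))"

lemma ogf_interp_invert:
  "ogf (interp_invert x a) = ogf a / (1 - fps_const x * fps_X * ogf a)"
  by (rule fps_ext) (simp add: ogf_def interp_invert_def)

lemma interp_invert_in_S_real:
  assumes "a \<in> S_real"
  shows "interp_invert x a \<in> S_real"
  using assms by (simp add: S_real_def interp_invert_def ogf_def fps_divide_unit)

lemma comp_inverses_unique:
  assumes "comp_inverses f g" and "comp_inverses f h"
  shows "g = h"
proof -
  have "g = g oo (f oo h)"
    using assms(2) by (simp add: comp_inverses_def)
  also have "\<dots> = (g oo f) oo h"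
    using assms by (intro fps_compose_assoc) (simp_all add: comp_inverses_def)
  also have "\<dots> = h"
    using assms by (simp add: comp_inverses_def)
  finally show ?thesis .
qed

lemma ex1_reversion:
  assumes "a \<in> S_real"
  shows "\<exists>!b. comp_inverses (fps_X * ogf a) (fps_X * ogf b)"
proof (rule ex_ex1I)
  define f where "f = fps_X * ogf a"
  have f: "f $ 0 = 0" "f $ 1 \<noteq> 0"
    using assms by (simp_all add: f_def ogf_def S_real_def)
  define g where "g = fps_inv f"
  have g0: "g $ 0 = 0"
    by (simp add: g_def fps_inv_def)
  have "g = fps_X * ogf (\<lambda>n. g $ Suc n)"
    by (rule fps_ext) (simp add: ogf_def g0)
  moreover have "comp_inverses f g"
    using f g0 by (simp add: comp_inverses_def g_def fps_inv fps_inv_right)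
  ultimately show "\<exists>b. comp_inverses (fps_X * ogf a) (fps_X * ogf b)"
    unfolding f_def by metis
next
  fix b c
  assume "comp_inverses (fps_X * ogf a) (fps_X * ogf b)"
    and "comp_inverses (fps_X * ogf a) (fps_X * ogf c)"
  then have "fps_X * ogf b = fps_X * ogf c"
    by (rule comp_inverses_unique)
  then have "ogf b = ogf c"
    by simp
  then show "b = c"
    by (simp add: ogf_def fun_eq_iff fps_eq_iff)
qed

lemma revert_eq_iff:
  assumes "a \<in> S_real"
  shows "revert a = b \<longleftrightarrow> comp_inverses (fps_X * ogf a) (fps_X * ogf b)"
  unfolding revert_def using ex1_reversion[OF assms] by (metis theI')

end

theory Submission
  imports Defs
begin

text \<open>
  Put \<open>f = t A(t)\<close>. Then \<open>I\<^sup>(\<^sup>x\<^sup>)\<close> turns \<open>f\<close> into \<open>f / (1 - x f)\<close>, so \<open>a\<close> is a fixed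
  point iff \<open>f \<circ> f = t / (1 + x t)\<close>. The right-hand side is the compositional square of the
  Moebius map \<open>t / (1 + (x/2) t)\<close>, and compositional square roots of the form \<open>t + \<dots>\<close> are unique.
\<close>

lemma fps_mult_nth_of_low_zero:
  fixes d s :: "'a::comm_ring_1 fps"
  assumes "\<And>k. k < n \<Longrightarrow> d $ k = 0"
  shows "(d * s) $ n = d $ n * s $ 0"
proof -
  have "(d * s) $ n = (\<Sum>i=0..n. if i = n then d $ n * s $ 0 else 0)"
    unfolding fps_mult_nth by (rule sum.cong) (auto simp: assms)
  then show ?thesis by simp
qed

text \<open>If \<open>f\<close> and \<open>g\<close> agree below degree \<open>n\<close> and
  \<open>d = f - g\<close>, pass from \<open>f oo f\<close> to \<open>g oo g\<close> through
  \<open>g oo f\<close>. Changing the outer series and changing the inner series each contribute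
  exactly \<open>d $ n\<close> in degree \<open>n\<close>, so \<open>2 * d $ n = 0\<close>, and
  characteristic zero gives \<open>d $ n = 0\<close>.\<close>

lemma fps_compose_self_inj:
  fixes f g :: "'a::{idom, ring_char_0} fps"
  assumes f: "f $ 0 = 0" "f $ 1 = 1" and g: "g $ 0 = 0" "g $ 1 = 1"
    and eq: "f oo f = g oo g"
  shows "f = g"
proof (rule fps_ext)
  fix n
  show "f $ n = g $ n"
  proof (induction n rule: less_induct)
    case (less n)
    show ?case
    proof (cases "n = 0")
      case True
      then show ?thesis using f g by simp
    next
      case False
      define d where "d = f - g"
      have low: "d $ k = 0" if "k < n" for k
        using less that by (simp add: d_def)
      \<comment> \<open>The difference factors as \<open>d\<close> times a cofactor, and
        \<open>d\<close> vanishes below degree \<open>n\<close>, so only the constant term of the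
        cofactor counts. As \<open>f $ 0 = g $ 0 = 0\<close>, that term is 1 for
        \<open>i = 1\<close> and 0 otherwise.\<close>
      have pow: "(f ^ i - g ^ i) $ n = (if i = 1 then d $ n else 0)" for i
      proof -
        have "f ^ i - g ^ i = d * (\<Sum>j<i. g ^ (i - Suc j) * f ^ j)"
          unfolding d_def by (rule power_diff_sumr2)
        then have "(f ^ i - g ^ i) $ n = d $ n * (\<Sum>j<i. g ^ (i - Suc j) * f ^ j) $ 0"
          by (simp only: fps_mult_nth_of_low_zero[OF low])
        also have "(\<Sum>j<i. g ^ (i - Suc j) * f ^ j) $ 0 = (\<Sum>j<i. if i = 1 then 1 else 0)"
          unfolding fps_sum_nth using f(1) g(1)
          by (intro sum.cong) (auto simp: power_0_left)
        finally show ?thesis by simp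
      qed
      have fn: "f ^ n $ n = 1"
        using f by (simp add: startsby_zero_power_nth_same)
      have "(d oo f) $ n = (\<Sum>i=0..n. if i = n then d $ n else 0)"
        unfolding fps_compose_nth by (rule sum.cong) (auto simp: low fn)
      then have df: "(d oo f) $ n = d $ n" by simp
      have "(g oo f) $ n - (g oo g) $ n = (\<Sum>i=0..n. g $ i * (f ^ i - g ^ i) $ n)"
        by (simp add: fps_compose_nth sum_subtractf algebra_simps)
      also have "\<dots> = (\<Sum>i=0..n. if i = 1 then d $ n else 0)"
        unfolding pow by (rule sum.cong) (use g in auto)
      also have "\<dots> = d $ n" using False by simp
      finally have gd: "(g oo f) $ n - (g oo g) $ n = d $ n" .
      have "(f oo f) $ n - (g oo f) $ n = (d oo f) $ n"
        by (simp add: d_def fps_compose_sub_distrib)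
      then have "2 * d $ n = 0" using df gd eq by (simp add: algebra_simps)
      then show ?thesis by (simp add: d_def)
    qed
  qed
qed

text \<open>The nonzero linear coefficient gives \<open>g\<close> a right inverse
  \<open>fps_inv g\<close>; associativity forces any left inverse \<open>f\<close> to coincide with
  it.\<close>

lemma comp_inverses_iff_left_inverse:
  assumes "f $ 0 = 0" "g $ 0 = 0" "g $ 1 \<noteq> 0"
  shows "comp_inverses f g \<longleftrightarrow> f oo g = fps_X"
proof
  assume fg: "f oo g = fps_X"
  have "f = f oo (g oo fps_inv g)"
    using assms by (simp add: fps_inv_right)
  also have "\<dots> = (f oo g) oo fps_inv g"
    using assms by (intro fps_compose_assoc) (simp_all add: fps_inv_def)
  also have "\<dots> = fps_inv g"
    by (simp add: fg fps_inv_def)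
  finally show "comp_inverses f g"
    using assms fg by (simp add: comp_inverses_def fps_inv_right)
qed (simp add: comp_inverses_def)

text \<open>Right composition with \<open>f\<close> is a ring homomorphism, so with h =
  \<open>f oo f\<close> the left side reads h / (1 - x h) = t. Solving for h inverts this Moebius
  map.\<close>

lemma fps_moebius_compose_eq_X_iff:
  fixes f :: "real fps"
  assumes f0: "f $ 0 = 0"
  shows "f / (1 - fps_const x * f) oo f = fps_X \<longleftrightarrow>
    (f oo f) * (1 + fps_const x * fps_X) = fps_X"
proof -
  let ?h = "f oo f" and ?F = "f / (1 - fps_const x * f)"
  \<comment> \<open>The constant term is 1.\<close>
  have unit: "1 - fps_const x * ?h \<noteq> 0"
    using f0 by (auto simp: fps_eq_iff intro!: exI[of _ 0])
  have "?F * (1 - fps_const x * f) = f"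
    using f0 by (simp add: fps_divide_unit mult.assoc inverse_mult_eq_1)
  then have "(?F * (1 - fps_const x * f)) oo f = ?h" by simp
  then have "(?F oo f) * (1 - fps_const x * ?h) = ?h"
    by (simp only: fps_compose_mult_distrib[OF f0] fps_compose_sub_distrib fps_compose_1
        fps_const_compose)
  then have "?F oo f = fps_X \<longleftrightarrow> fps_X * (1 - fps_const x * ?h) = ?h"
    using unit by (metis mult_right_cancel)
  also have "\<dots> \<longleftrightarrow> ?h * (1 + fps_const x * fps_X) = fps_X"
    by (auto simp: algebra_simps)
  finally show ?thesis .
qed

text \<open>The hypothesis says 1/f = 1/t + c: in the coordinate 1/t the map is a translation by c,
  so applying it twice translates by 2c.\<close>

lemma fps_moebius_compose_self:
  fixes f :: "real fps"
  assumes f0: "f $ 0 = 0" and f: "f * (1 + fps_const c * fps_X) = fps_X"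
  shows "(f oo f) * (1 + fps_const (2 * c) * fps_X) = fps_X"
proof -
  have "(f * (1 + fps_const c * fps_X)) oo f = f"
    using f f0 by simp
  then have "(f oo f) * (1 + fps_const c * f) = f"
    using f0 by (simp add: fps_compose_mult_distrib fps_compose_add_distrib)
  \<comment> \<open>Multiplying by 1 + c t makes \<open>f\<close> occur only in the product
    \<open>f * (1 + fps_const c * fps_X)\<close>, which is t.\<close>
  then have "(f oo f) * ((1 + fps_const c * fps_X) + fps_const c * (f * (1 + fps_const c * fps_X)))
      = f * (1 + fps_const c * fps_X)"
    by (metis (no_types, lifting) distrib_right mult.assoc mult_1_left)
  then show ?thesis
    unfolding f by (simp add: fps_const_mult[symmetric] numeral_fps_const[symmetric] algebra_simps)
qed

theorem theorem10:
  fixes x :: real and a :: "nat \<Rightarrow> real"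
  assumes "a \<in> S_real"
  shows "(revert \<circ> interp_invert x) a = a \<longleftrightarrow>
    ogf a = 1 / (1 + fps_const (x / 2) * fps_X)"
proof -
  define f where "f = fps_X * ogf a"
  define r where "r = 1 + fps_const (x / 2) * fps_X"
  define m where "m = fps_X * inverse r"
  have r0: "r $ 0 \<noteq> 0" by (simp add: r_def)
  have f: "f $ 0 = 0" "f $ 1 = 1"
    using assms by (simp_all add: f_def ogf_def S_real_def)
  have m: "m $ 0 = 0" "m $ 1 = 1"
    by (simp_all add: m_def r_def)
  have "m * r = fps_X"
    using r0 by (simp add: m_def mult.assoc inverse_mult_eq_1)
  then have mm: "(m oo m) * (1 + fps_const x * fps_X) = fps_X"
    using fps_moebius_compose_self[OF m(1), of "x / 2"] by (simp add: r_def)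
  \<comment> \<open>In an integral domain h (1 + x t) = t has at most one solution h, and
    \<open>m oo m\<close> is one.\<close>
  have "1 + fps_const x * fps_X \<noteq> 0"
    by (auto simp: fps_eq_iff intro!: exI[of _ 0])
  then have sq: "(f oo f) * (1 + fps_const x * fps_X) = fps_X \<longleftrightarrow> f oo f = m oo m"
    using mm by (metis mult_right_cancel)
  have F: "fps_X * ogf (interp_invert x a) = f / (1 - fps_const x * f)"
    by (simp add: ogf_interp_invert f_def fps_divide_unit mult.assoc)
  have "(revert \<circ> interp_invert x) a = a \<longleftrightarrow>
      comp_inverses (f / (1 - fps_const x * f)) f"
    using revert_eq_iff[OF interp_invert_in_S_real[OF assms], of x a]
    unfolding F f_def[symmetric] by simp
  \<comment> \<open>Here \<open>f\<close> itself is the candidate inverse, and its linear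
    coefficient is 1.\<close>
  also have "\<dots> \<longleftrightarrow> f / (1 - fps_const x * f) oo f = fps_X"
    using f by (intro comp_inverses_iff_left_inverse) (simp_all add: fps_divide_unit)
  also have "\<dots> \<longleftrightarrow> f oo f = m oo m"
    unfolding fps_moebius_compose_eq_X_iff[OF f(1)] by (rule sq)
  also have "\<dots> \<longleftrightarrow> f = m"
    using fps_compose_self_inj[OF f m] by auto
  also have "\<dots> \<longleftrightarrow> ogf a = 1 / r"
    using r0 by (simp add: f_def m_def fps_divide_unit)
  finally show ?thesis unfolding r_def .
qed

end
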